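(* Let $F: \mathbb{R}^2 \to \mathbb{R}^2$ be an excellent smooth function with critical set $C$. Let $\gamma$ be a positively oriented smooth simple closed curve bounding a closed topological disk $\Delta$ with $\Delta \cap C = \emptyset$. Then $F(\gamma)$, the image of $\gamma$ under $F$, is a smooth curve (that is, if $c$ is a regular parametrization of $\gamma$ then $F\circ c$ is a parametrized regular closed curve) and $$ r(F(\gamma)) = \operatorname{sgn} \det DF(p) \quad\text{for any } p \in \Delta. $$
   Context: For smooth $F:\mathbb{R}^2\to\mathbb{R}^2$, the critical set $C$ is the set of points $p$ where $DF(p)$ is not invertible. A critical point $p_f$ is a fold if there are local diffeomorphisms $\Psi$ (from a neighborhood of $p_f$ to a neighborhood of $0$, $\Psi(p_f)=0$) and $\Phi$ (from a neighborhood of $0$ to a neighborhood of $F(p_f)$, $\Phi(0)=F(p_f)$) with $F=\Phi\circ\tilde F\circ\Psi$ near $p_f$, where $\tilde F(x,y)=(x,y^2)$; a critical point is a cusp if the same holds with $\tilde F(x,y)=(x,y^3-xy)$. $F$ is excellent if all its critical points are folds or cusps. Let $\mathbb{S}^1$ be the unit circle and $e:[0,2\pi]\to\mathbb{S}^1$, $e(t)=(\cos t,\sin t)$. A parametrized regular closed curve (prc-curve) is a $C^1$ function $c:\mathbb{S}^1\to\mathbb{R}^2$ with $(c\circ e)'(t)\neq 0$ for all $t$; its image is an oriented curve, possibly with self-intersections. Its rotation number $r(c)$ is the winding number around $0$ of the closed curve $t\mapsto (c\circ e)'(t)$, $t\in[0,2\pi]$. The rotation number does not change under orientation preserving $C^1$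 reparametrizations of $\mathbb{S}^1$, so one writes $r(\gamma)$ for the oriented curve $\gamma$; $F(\gamma)$ is oriented by the parametrization $F\circ c$ where $c$ is a regular parametrization of $\gamma$ compatible with its orientation. Positively oriented means counterclockwise. $\operatorname{sgn}(x)=1$ for $x>0$ and $-1$ for $x<0$. *)

theory Defs
  imports "HOL-Complex_Analysis.Complex_Analysis"
begin

primrec higher_differentiable_on ::
  "'a::real_normed_vector set \<Rightarrow> ('a \<Rightarrow> 'b::real_normed_vector) \<Rightarrow> nat \<Rightarrow> bool" where
  "higher_differentiable_on S f 0 \<longleftrightarrow> continuous_on S f"
| "higher_differentiable_on S f (Suc n) \<longleftrightarrow>
     (\<forall>x\<in>S. f differentiable (at x)) \<and>
     (\<forall>v. higher_differentiable_on S (\<lambda>x. frechet_derivative f (at x) v) n)"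

text \<open>Smooth means of class \<open>C\<^sup>\<infinity>\<close>. The derivatives are taken in the full space, so the
  notion is meant for open \<open>S\<close> only.\<close>

definition smooth_on :: "'a::real_normed_vector set \<Rightarrow> ('a \<Rightarrow> 'b::real_normed_vector) \<Rightarrow> bool" where
  "smooth_on S f \<longleftrightarrow> (\<forall>n. higher_differentiable_on S f n)"

definition diffeomorphism_between ::
  "(real^2) set \<Rightarrow> (real^2) set \<Rightarrow> (real^2 \<Rightarrow> real^2) \<Rightarrow> bool" where
  "diffeomorphism_between U V f \<longleftrightarrow>
     open U \<and> open V \<and> bij_betw f U V \<and> smooth_on U f \<and> smooth_on V (inv_into U f)"

definition critical_set :: "(real^2 \<Rightarrow> real^2) \<Rightarrow> (real^2) set" where
  "critical_set F = {p. \<not> invertible (jacobian F (at p))}"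

definition has_normal_form_at ::
  "(real^2 \<Rightarrow> real^2) \<Rightarrow> (real^2 \<Rightarrow> real^2) \<Rightarrow> real^2 \<Rightarrow> bool" where
  "has_normal_form_at F G p \<longleftrightarrow>
     (\<exists>U V W Z \<Psi> \<Phi>.
        p \<in> U \<and> diffeomorphism_between U V \<Psi> \<and> \<Psi> p = 0 \<and>
        0 \<in> W \<and> diffeomorphism_between W Z \<Phi> \<and> \<Phi> 0 = F p \<and>
        (\<forall>\<^sub>F x in nhds p. F x = \<Phi> (G (\<Psi> x))))"

definition fold_map :: "real^2 \<Rightarrow> real^2" where
  "fold_map v = vector [v $ 1, (v $ 2)^2]"

definition cusp_map :: "real^2 \<Rightarrow> real^2" where
  "cusp_map v = vector [v $ 1, (v $ 2)^3 - v $ 1 * v $ 2]"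

definition fold_point :: "(real^2 \<Rightarrow> real^2) \<Rightarrow> real^2 \<Rightarrow> bool" where
  "fold_point F p \<longleftrightarrow> p \<in> critical_set F \<and> has_normal_form_at F fold_map p"

definition cusp_point :: "(real^2 \<Rightarrow> real^2) \<Rightarrow> real^2 \<Rightarrow> bool" where
  "cusp_point F p \<longleftrightarrow> p \<in> critical_set F \<and> has_normal_form_at F cusp_map p"

definition excellent :: "(real^2 \<Rightarrow> real^2) \<Rightarrow> bool" where
  "excellent F \<longleftrightarrow> (\<forall>p\<in>critical_set F. fold_point F p \<or> cusp_point F p)"

text \<open>The map \<open>t \<mapsto> (cos t, sin t)\<close> is taken on the whole line instead of \<open>[0, 2\<pi>]\<close>.
  Functions on the unit circle are functions on the plane of which only the values on
  \<open>sphere 0 1\<close> matter. Since the local inverses of \<open>circle_param\<close> are the charts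
  of the circle, \<open>c\<close> is \<open>C\<^sup>1\<close> on the circle iff \<open>c \<circ> circle_param\<close> is \<open>C\<^sup>1\<close> on the line
  (on \<open>[0, 2\<pi>]\<close> alone, the one-sided derivatives at the end points might differ).\<close>

definition circle_param :: "real \<Rightarrow> real^2" where
  "circle_param t = vector [cos t, sin t]"

definition prc_curve :: "(real^2 \<Rightarrow> real^2) \<Rightarrow> bool" where
  "prc_curve c \<longleftrightarrow>
     (c \<circ> circle_param) C1_differentiable_on UNIV \<and>
     (\<forall>t. vector_derivative (c \<circ> circle_param) (at t) \<noteq> 0)"

definition complex_of_vec :: "real^2 \<Rightarrow> complex" where
  "complex_of_vec v = Complex (v $ 1) (v $ 2)"

text \<open>The winding number around \<open>z\<close> of a closed curve parametrized over \<open>[0, 2\<pi>]\<close>; the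
  library parametrizes paths over \<open>[0, 1]\<close>.\<close>

definition plane_winding_number :: "(real \<Rightarrow> real^2) \<Rightarrow> real^2 \<Rightarrow> complex" where
  "plane_winding_number g z =
     winding_number (\<lambda>s. complex_of_vec (g (2 * pi * s))) (complex_of_vec z)"

definition rotation_number :: "(real^2 \<Rightarrow> real^2) \<Rightarrow> complex" where
  "rotation_number c =
     plane_winding_number (\<lambda>t. vector_derivative (c \<circ> circle_param) (at t)) 0"

definition simple_regular_parametrization :: "(real^2 \<Rightarrow> real^2) \<Rightarrow> (real^2) set \<Rightarrow> bool" where
  "simple_regular_parametrization c \<gamma> \<longleftrightarrow>
     prc_curve c \<and> inj_on c (sphere 0 1) \<and> c ` sphere 0 1 = \<gamma>"

definition smooth_simple_closed_curve :: "(real^2) set \<Rightarrow> bool" where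
  "smooth_simple_closed_curve \<gamma> \<longleftrightarrow> (\<exists>c. simple_regular_parametrization c \<gamma>)"

text \<open>Counterclockwise, for a simple closed curve: it winds once, in the positive sense,
  around the points it encloses.\<close>

definition positively_oriented :: "(real^2 \<Rightarrow> real^2) \<Rightarrow> bool" where
  "positively_oriented c \<longleftrightarrow>
     (\<forall>z\<in>inside (c ` sphere 0 1). plane_winding_number (c \<circ> circle_param) z = 1)"

definition closed_disk_bounded_by :: "(real^2) set \<Rightarrow> (real^2) set \<Rightarrow> bool" where
  "closed_disk_bounded_by \<Delta> \<gamma> \<longleftrightarrow> \<Delta> homeomorphic cball (0::real^2) 1 \<and> frontier \<Delta> = \<gamma>"

end

theory Submission
  imports Defs
begin

text \<open>The disk \<open>\<Delta>\<close> contracts to any of its points \<open>p\<close>, and \<open>DF\<close> is invertible along the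
  contraction. Hence the velocity \<open>DF(c t) (c' t)\<close> of \<open>F \<circ> c\<close> is homotopic, as a loop avoiding \<open>0\<close>,
  to \<open>DF(p) (c' t)\<close>, and a real linear map \<open>z \<mapsto> a z + b cnj z\<close> of the plane multiplies winding
  numbers around \<open>0\<close> by the sign of \<open>|a|\<^sup>2 - |b|\<^sup>2 = det\<close>. This leaves Hopf's Umlaufsatz, \<open>r(c) = 1\<close>.

  Hopf's secant map on the triangle \<open>0 \<le> s \<le> t \<le> 1\<close> shows that \<open>r(c) = 2k\<close>, where \<open>2\<pi>k\<close> is the
  variation of the argument of \<open>c(t) - c(0)\<close> along the open curve. A point slightly displaced from
  \<open>c(0)\<close> to the left or to the right along the normal has index \<open>k + 1/2\<close> or \<open>k - 1/2\<close>. Since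
  \<open>c\<close> is positively oriented, both indices are \<open>0\<close> or \<open>1\<close>, so \<open>k = 1/2\<close>.\<close>

section \<open>The secant map\<close>

text \<open>Hadamard's lemma: \<open>E s t\<close> is the mean of \<open>g'\<close> over the segment
  from \<open>s\<close> to \<open>t\<close>, so it stays continuous across the diagonal, where the
  difference quotient is undefined.\<close>

lemma secant_factorization:
  fixes g g' :: "real \<Rightarrow> complex"
  assumes der: "\<And>t. (g has_vector_derivative g' t) (at t)"
    and cont: "continuous_on UNIV g'"
  obtains E where "continuous_on UNIV (\<lambda>(s, t). E s t)"
    and "\<And>s t. g t - g s = of_real (t - s) * E s t"
    and "\<And>t. E t t = g' t"
proof -
  define E where "E s t = integral (cbox 0 1) (\<lambda>u. g' (s + u * (t - s)))" for s t
  have "continuous_on UNIV (\<lambda>p. integral (cbox 0 1) (\<lambda>u. g' (fst p + u * (snd p - fst p))))"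
    by (intro integral_continuous_on_param)
      (auto intro!: continuous_intros continuous_on_compose2[OF cont] simp: case_prod_unfold)
  then have "continuous_on UNIV (\<lambda>(s, t). E s t)"
    by (simp add: E_def case_prod_unfold)
  moreover have "g t - g s = of_real (t - s) * E s t" for s t
  proof -
    let ?h = "\<lambda>u. s + u * (t - s)"
    have "((\<lambda>u. (t - s) *\<^sub>R g' (?h u)) has_integral (g \<circ> ?h) 1 - (g \<circ> ?h) 0) {0..1}"
    proof (rule fundamental_theorem_of_calculus)
      fix u :: real
      have "(?h has_vector_derivative (t - s)) (at u within {0..1})"
        by (auto intro!: derivative_eq_intros)
      then show "(g \<circ> ?h has_vector_derivative (t - s) *\<^sub>R g' (?h u)) (at u within {0..1})"
        by (rule vector_diff_chain_within) (rule has_vector_derivative_at_within[OF der])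
    qed simp
    then have "g t - g s = integral {0..1} (\<lambda>u. (t - s) *\<^sub>R g' (?h u))"
      by (intro integral_unique[symmetric]) simp
    also have "\<dots> = of_real (t - s) * E s t"
      by (simp only: integral_cmul E_def scaleR_conv_of_real cbox_interval)
        (simp add: scaleR_conv_of_real[symmetric])
    finally show ?thesis .
  qed
  moreover have "E t t = g' t" for t
    by (simp add: E_def)
  ultimately show ?thesis
    using that by blast
qed

lemma has_vector_derivative_periodic:
  fixes g :: "real \<Rightarrow> 'a::real_normed_vector"
  assumes der: "\<And>t. (g has_vector_derivative g' t) (at t)"
    and per: "\<And>t. g (t + p) = g t"
  shows "g' (t + p) = g' t"
proof -
  have "((\<lambda>t. t + p) has_vector_derivative 1) (at t)"
    by (auto intro!: derivative_eq_intros)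
  from vector_diff_chain_at[OF this der]
  have "(g has_vector_derivative g' (t + p)) (at t)"
    by (simp add: o_def per)
  then show ?thesis
    using der vector_derivative_at by metis
qed

text \<open>Dividing by \<open>(t - s) * (1 - (t - s))\<close> instead of by the distance makes the secant map
  extend continuously to the whole closed triangle.\<close>

lemma secant_quotient:
  fixes g g' :: "real \<Rightarrow> complex"
  assumes der: "\<And>t. (g has_vector_derivative g' t) (at t)"
    and cont: "continuous_on UNIV g'"
    and per: "\<And>t. g (t + 1) = g t"
  obtains G where "continuous_on {(s, t). 0 \<le> s \<and> s \<le> t \<and> t \<le> 1} G"
    and "\<And>s t. \<lbrakk>0 \<le> s; s \<le> t; t \<le> 1\<rbrakk> \<Longrightarrow>
      g t - g s = of_real ((t - s) * (1 - (t - s))) * G (s, t)"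
    and "\<And>t. G (t, t) = g' t"
    and "G (0, 1) = - g' 0"
    and "\<And>t. \<lbrakk>0 \<le> t; t \<le> 1\<rbrakk> \<Longrightarrow> G (t, 1) = - G (0, t)"
proof -
  obtain E where contE: "continuous_on UNIV (\<lambda>(s, t). E s t)"
    and E: "\<And>s t. g t - g s = of_real (t - s) * E s t"
    and Ediag: "\<And>t. E t t = g' t"
    using secant_factorization[OF der cont] by metis
  have per': "g' (t + 1) = g' t" for t
    by (rule has_vector_derivative_periodic[OF der per])
  \<comment> \<open>Periodicity lets \<open>s + 1\<close> replace \<open>s\<close>. On the triangle
    the new factor vanishes only at the corner (0, 1) instead of on the diagonal.\<close>
  have E1: "g t - g s = of_real (t - s - 1) * E (s + 1) t" for s t
    using E[of t "s + 1"] per[of s] by (simp add: algebra_simps)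
  define T where "T = {(s::real, t::real). 0 \<le> s \<and> s \<le> t \<and> t \<le> 1}"
  \<comment> \<open>The two factorizations serve the two sides of \<open>t - s = 1/2\<close>, so
    each denominator stays at least 1/2.\<close>
  define G where "G = (\<lambda>p. if snd p - fst p \<le> 1/2 then E (fst p) (snd p) / of_real (1 - (snd p - fst p))
     else - (E (fst p + 1) (snd p) / of_real (snd p - fst p)))"
  have cE: "continuous_on S (\<lambda>p. E (a p) (b p))"
    if "continuous_on S a" "continuous_on S b" for S and a b :: "real \<times> real \<Rightarrow> real"
    using continuous_on_compose2[OF contE, of S "\<lambda>p. (a p, b p)"] that
    by (simp add: continuous_on_Pair)
  have GE: "g t - g s = of_real ((t - s) * (1 - (t - s))) * G (s, t)"
    if "0 \<le> s" "s \<le> t" "t \<le> 1" for s t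
  proof (cases "t - s \<le> 1/2")
    case True
    then have "complex_of_real (1 - (t - s)) \<noteq> 0"
      by (simp del: of_real_diff)
    then show ?thesis
      using True E[of t s] unfolding G_def by (simp del: of_real_diff)
  next
    case False
    then have "complex_of_real (t - s) \<noteq> 0"
      by (simp del: of_real_diff)
    then have "of_real ((t - s) * (1 - (t - s))) * G (s, t) = - of_real (1 - (t - s)) * E (s + 1) t"
      using False unfolding G_def by (simp del: of_real_diff)
    also have "\<dots> = of_real (t - s - 1) * E (s + 1) t"
      by (simp flip: of_real_minus)
    finally show ?thesis
      using E1[of t s] by simp
  qed
  \<comment> \<open>The two branches of \<open>G\<close> agree on the seam, which allows
    gluing.\<close>
  have half: "E s t / of_real (1 - (t - s)) = - (E (s + 1) t / of_real (t - s))"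
    if "t - s = 1/2" for s t
  proof -
    have "of_real (t - s) * E s t = of_real (t - s - 1) * E (s + 1) t"
      using E E1 by metis
    then show ?thesis
      using that by (simp del: of_real_diff)
  qed
  have "continuous_on T G"
  proof -
    have eq: "T = {p \<in> T. snd p - fst p \<le> 1/2} \<union> {p \<in> T. snd p - fst p \<ge> 1/2}"
      by auto
    have "closed {p \<in> T. snd p - fst p \<le> 1/2}" "closed {p \<in> T. snd p - fst p \<ge> 1/2}"
      unfolding T_def case_prod_unfold mem_Collect_eq
      by (intro closed_Collect_conj closed_Collect_le continuous_intros)+
    then show ?thesis
      unfolding G_def
      by (subst eq, intro continuous_on_cases continuous_intros cE)
        (auto simp: half simp del: of_real_diff)
  qed
  moreover have "G (t, t) = g' t" for t
    by (simp add: G_def Ediag)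
  moreover have G01: "G (0, 1) = - g' 0"
    using Ediag[of 1] per'[of 0] by (simp add: G_def)
  \<comment> \<open>Both chords join the same two points of the closed curve, in opposite directions
    and with the same factor \<open>t * (1 - t)\<close>. At the ends this factor vanishes, and the
    values are read off from \<open>G_def\<close>.\<close>
  moreover have "G (t, 1) = - G (0, t)" if t: "0 \<le> t" "t \<le> 1" for t
  proof (cases "t = 0 \<or> t = 1")
    case True
    then show ?thesis
      using G01 Ediag[of 1] Ediag[of 0] per'[of 0] by (auto simp: G_def)
  next
    case False
    have "of_real (t * (1 - t)) * G (t, 1) = - (of_real (t * (1 - t)) * G (0, t))"
      using GE[of t 1] GE[of 0 t] t per[of 0]
      by (simp add: eq_neg_iff_add_eq_0 add.commute algebra_simps del: of_real_diff of_real_mult)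
    moreover have "complex_of_real (t * (1 - t)) \<noteq> 0"
      using False by (simp del: of_real_diff of_real_mult)
    ultimately show ?thesis
      by (metis mult_cancel_left mult_minus_right)
  qed
  ultimately show ?thesis
    using that GE unfolding T_def by blast
qed

section \<open>The rotation number of a simple closed curve\<close>

text \<open>\<open>q\<close> is a continuous logarithm of the curve seen from \<open>z\<close>, so a
  winding number is found from the end values of \<open>q\<close> alone.\<close>

lemma winding_number_log:
  assumes "path q" and "\<And>t. \<lbrakk>0 \<le> t; t \<le> 1\<rbrakk> \<Longrightarrow> p t - z = exp (q t)"
  shows "winding_number p z = (q 1 - q 0) / (2 * of_real pi * \<i>)"
    and "z \<notin> path_image p"
proof -
  have "winding_number p z = winding_number (\<lambda>t. p t - z) 0"
    by (rule winding_number_offset)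
  also have "\<dots> = winding_number (exp \<circ> q) 0"
    using assms(2) by (intro winding_number_cong) simp
  also have "\<dots> = (q 1 - q 0) / (2 * of_real pi * \<i>)"
    using winding_number_compose_exp[OF assms(1)] by (simp add: pathfinish_def pathstart_def)
  finally show "winding_number p z = (q 1 - q 0) / (2 * of_real pi * \<i>)" .
  show "z \<notin> path_image p"
    unfolding path_image_def using assms(2) by fastforce
qed

text \<open>An intersection of three half-planes. Convexity gives contractibility, hence a
  continuous logarithm of the nonvanishing secant map.\<close>

lemma convex_triangle: "convex {(s::real, t). 0 \<le> s \<and> s \<le> t \<and> t \<le> 1}"
proof -
  have "{(s::real, t). 0 \<le> s \<and> s \<le> t \<and> t \<le> 1} =
      {p. (- 1, 0) \<bullet> p \<le> 0} \<inter> {p. (1, - 1) \<bullet> p \<le> 0} \<inter> {p. (0, 1) \<bullet> p \<le> 1}"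
    by (auto simp: inner_prod_def)
  then show ?thesis
    by (simp add: convex_Int convex_halfspace_le)
qed

text \<open>Apart from the factor \<open>exp (q t)\<close>, the curve seen from \<open>z\<close> is \<open>t (1 - t) - i \<sigma> \<epsilon> R t\<close>, which for
  small \<open>\<epsilon>\<close> runs from \<open>- i \<sigma> \<epsilon>\<close> to \<open>i \<sigma> \<epsilon>\<close> within the domain of the principal logarithm.\<close>

lemma winding_number_displaced:
  fixes g q :: "real \<Rightarrow> complex" and \<sigma> :: real
  assumes q: "path q" and v: "exp (q 0) = v" "exp (q 1) = - v"
    and g: "\<And>t. \<lbrakk>0 \<le> t; t \<le> 1\<rbrakk> \<Longrightarrow> g t - a = of_real (t * (1 - t)) * exp (q t)"
    and \<sigma>: "\<sigma> = 1 \<or> \<sigma> = -1"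
  obtains z where "z \<notin> path_image g"
    and "winding_number g z = (q 1 - q 0) / (2 * of_real pi * \<i>) + of_real (\<sigma> / 2)"
proof -
  \<comment> \<open>\<open>R\<close> compares the initial direction \<open>v\<close> with
    \<open>exp (q t)\<close>; it runs from 1 to -1.\<close>
  define R where "R t = v / exp (q t)" for t
  have contq: "continuous_on {0..1} q"
    using q by (simp add: path_def)
  have contR: "continuous_on {0..1} R"
    unfolding R_def by (intro continuous_intros contq) auto
  have R0: "R 0 = 1" and R1: "R 1 = -1" and vnz: "v \<noteq> 0"
    using v by (auto simp: R_def)
  \<comment> \<open>Only at these times can \<open>P t\<close> below be real, so only there does
    \<epsilon> have to keep it off the negative axis.\<close>
  define K where "K = {t \<in> {0..1}. Re (R t) = 0}"
  have "compact K"
  proof -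
    have "closed K"
      unfolding K_def
      by (intro continuous_closed_preimage_constant continuous_intros contR closed_atLeastAtMost)
    moreover have "K \<subseteq> {0..1}"
      by (auto simp: K_def)
    ultimately show ?thesis
      by (meson bounded_closed_interval bounded_subset compact_eq_bounded_closed)
  qed
  have K01: "0 < t \<and> t < 1" if "t \<in> K" for t
    using that R0 R1 by (cases "t = 0 \<or> t = 1") (auto simp: K_def)
  \<comment> \<open>Half the minimum over \<open>K\<close> of
    \<open>t * (1 - t) / cmod (R t)\<close>; it is positive because \<open>K\<close> is compact and
    misses 0 and 1.\<close>
  obtain \<epsilon> where \<epsilon>: "\<epsilon> > 0" "\<And>t. t \<in> K \<Longrightarrow> \<epsilon> * cmod (R t) < t * (1 - t)"
  proof (cases "K = {}")
    case True
    then show ?thesis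
      using that[of 1] by simp
  next
    case False
    have Rnz: "R t \<noteq> 0" for t
      using vnz by (simp add: R_def)
    let ?f = "\<lambda>t. t * (1 - t) / cmod (R t)"
    have "continuous_on K ?f"
      by (intro continuous_intros continuous_on_subset[OF contR]) (auto simp: K_def Rnz)
    then obtain t0 where t0: "t0 \<in> K" "\<And>t. t \<in> K \<Longrightarrow> ?f t0 \<le> ?f t"
      using continuous_attains_inf[OF \<open>compact K\<close> False] by blast
    have pos: "0 < ?f t0"
      using K01[OF t0(1)] Rnz by simp
    have half: "x / 2 < x" if "0 < x" for x :: real
      using that by simp
    show ?thesis
    proof (rule that)
      show "0 < ?f t0 / 2"
        using pos by simp
      fix t assume "t \<in> K"
      then have "?f t0 / 2 < ?f t"
        using order.strict_trans2[OF half[OF pos] t0(2)] by simp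
      then show "?f t0 / 2 * cmod (R t) < t * (1 - t)"
        using Rnz[of t] by (simp add: pos_less_divide_eq)
    qed
  qed
  \<comment> \<open>A small displacement along the normal \<open>\<i> * v\<close>, to the left for
    \<sigma> = 1 and to the right for \<sigma> = -1.\<close>
  define z where "z = a + \<i> * of_real (\<sigma> * \<epsilon>) * v"
  define P where "P t = of_real (t * (1 - t)) - \<i> * of_real (\<sigma> * \<epsilon>) * R t" for t
  have Pslit: "P t \<notin> \<real>\<^sub>\<le>\<^sub>0" if t: "0 \<le> t" "t \<le> 1" for t
  proof
    assume P: "P t \<in> \<real>\<^sub>\<le>\<^sub>0"
    then have "Re (R t) = 0"
      using \<sigma> \<epsilon>(1) by (auto simp: P_def complex_nonpos_Reals_iff)
    then have "\<epsilon> * cmod (R t) < t * (1 - t)"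
      using t by (intro \<epsilon>) (simp add: K_def)
    moreover have "\<epsilon> * \<bar>Im (R t)\<bar> \<le> \<epsilon> * cmod (R t)"
      using \<epsilon>(1) by (intro mult_left_mono abs_Im_le_cmod) auto
    moreover have "\<bar>\<sigma> * \<epsilon> * Im (R t)\<bar> = \<epsilon> * \<bar>Im (R t)\<bar>"
      using \<sigma> \<epsilon>(1) by (auto simp: abs_mult)
    moreover have "t * (1 - t) + \<sigma> * \<epsilon> * Im (R t) \<le> 0"
      using P by (auto simp: P_def complex_nonpos_Reals_iff)
    ultimately show False
      by linarith
  qed
  have "continuous_on {0..1} P"
    unfolding P_def by (intro continuous_intros contR)
  then have path: "path (\<lambda>t. q t + Ln (P t))"
    unfolding path_def by (intro continuous_intros contq) (auto simp: Pslit)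
  have factor: "g t - z = exp (q t + Ln (P t))" if t: "0 \<le> t" "t \<le> 1" for t
  proof -
    have "P t \<noteq> 0"
      using Pslit[OF t] by auto
    then have "exp (q t + Ln (P t)) = exp (q t) * P t"
      by (simp add: exp_add)
    also have "\<dots> = of_real (t * (1 - t)) * exp (q t) - \<i> * of_real (\<sigma> * \<epsilon>) * v"
      by (simp add: P_def R_def algebra_simps)
    also have "\<dots> = g t - z"
      using g[OF t] by (simp add: z_def algebra_simps)
    finally show ?thesis ..
  qed
  \<comment> \<open>The argument of \<open>P\<close> goes from -\<sigma>\<pi>/2 to \<sigma>\<pi>/2:
    this half turn is the summand \<open>\<sigma> / 2\<close> of the index.\<close>
  have "Ln (P 1) - Ln (P 0) = \<i> * of_real (\<sigma> * pi)"
  proof -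
    have "P 0 = of_real \<epsilon> * (- of_real \<sigma> * \<i>)" "P 1 = of_real \<epsilon> * (of_real \<sigma> * \<i>)"
      by (simp_all add: P_def R0 R1)
    then show ?thesis
      using \<sigma> Ln_times_of_real[OF \<epsilon>(1), of \<i>] Ln_times_of_real[OF \<epsilon>(1), of "- \<i>"] by auto
  qed
  then have "winding_number g z = (q 1 - q 0) / (2 * of_real pi * \<i>) + of_real (\<sigma> / 2)"
    using winding_number_log(1)[OF path factor] by (simp add: field_simps)
  then show ?thesis
    using that winding_number_log(2)[OF path factor] by blast
qed

text \<open>Positive orientation enters through \<open>idx\<close>. A logarithm of the secant map
  compares the diagonal of the triangle, which carries the velocity, with the two legs, which carry
  the chords through \<open>g 0\<close>.\<close>

theorem umlaufsatz:
  fixes g g' :: "real \<Rightarrow> complex"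
  assumes der: "\<And>t. (g has_vector_derivative g' t) (at t)"
    and cont: "continuous_on UNIV g'"
    and per: "\<And>t. g (t + 1) = g t"
    and reg: "\<And>t. g' t \<noteq> 0"
    and inj: "\<And>s t. \<lbrakk>0 \<le> s; s < t; t \<le> 1; t - s < 1\<rbrakk> \<Longrightarrow> g s \<noteq> g t"
    and idx: "\<And>z. z \<notin> path_image g \<Longrightarrow> winding_number g z \<in> {0, 1}"
  shows "winding_number g' 0 = 1"
proof -
  let ?T = "{(s::real, t). 0 \<le> s \<and> s \<le> t \<and> t \<le> 1}"
  obtain G where contG: "continuous_on ?T G"
    and G: "\<And>s t. \<lbrakk>0 \<le> s; s \<le> t; t \<le> 1\<rbrakk> \<Longrightarrow>
      g t - g s = of_real ((t - s) * (1 - (t - s))) * G (s, t)"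
    and Gdiag: "\<And>t. G (t, t) = g' t"
    and G01: "G (0, 1) = - g' 0"
    and Gedge: "\<And>t. \<lbrakk>0 \<le> t; t \<le> 1\<rbrakk> \<Longrightarrow> G (t, 1) = - G (0, t)"
    by (rule secant_quotient[OF der cont per]) (rule that)
  \<comment> \<open>Regularity covers the diagonal and injectivity the rest, except the corner (0,
    1), where the curve closes up and \<open>G\<close> is minus the velocity.\<close>
  have Gnz: "G p \<noteq> 0" if pT: "p \<in> ?T" for p
  proof -
    obtain s t where p: "p = (s, t)" "0 \<le> s" "s \<le> t" "t \<le> 1"
      using pT by (cases p) auto
    consider "s = t" | "s < t" "t - s < 1" | "s = 0" "t = 1"
      using p by linarith
    then show ?thesis
    proof cases
      case 1
      then show ?thesis
        using p Gdiag reg by simp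
    next
      case 2
      then show ?thesis
        using G[of s t] inj[of s t] p by auto
    next
      case 3
      then show ?thesis
        using p G01 reg by simp
    qed
  qed
  obtain L where contL: "continuous_on ?T L" and L: "\<And>p. p \<in> ?T \<Longrightarrow> G p = exp (L p)"
    by (rule continuous_logarithm_on_contractible[OF contG convex_imp_contractible[OF convex_triangle] Gnz])
      (auto intro: that)
  have pathL: "path (\<lambda>t. L (a t, b t))"
    if "continuous_on {0..1} a" "continuous_on {0..1} b"
      "\<And>t. \<lbrakk>0 \<le> t; t \<le> 1\<rbrakk> \<Longrightarrow> (a t, b t) \<in> ?T" for a b
    unfolding path_def
    by (rule continuous_on_compose2[OF contL]) (use that in \<open>auto intro!: continuous_on_Pair\<close>)
  have "winding_number g' 0 = (L (1, 1) - L (0, 0)) / (2 * of_real pi * \<i>)"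
    by (rule winding_number_log(1), rule pathL) (auto simp: Gdiag[symmetric] L intro!: continuous_intros)
  \<comment> \<open>Both legs contribute equally: by \<open>Gedge\<close>,
    \<open>L (t, 1) - L (0, t)\<close> is a continuous logarithm of the constant -1, and a constant
    path has winding number 0.\<close>
  moreover have "L (1, 1) - L (0, 0) = 2 * (L (0, 1) - L (0, 0))"
  proof -
    have "path (\<lambda>t. L (t, 1) - L (0, t))"
      using pathL[of "\<lambda>t. t" "\<lambda>_. 1"] pathL[of "\<lambda>_. 0" "\<lambda>t. t"]
      unfolding path_def by (auto intro!: continuous_intros)
    \<comment> \<open>The left side has the shape \<open>p t - z\<close> of
      \<open>winding_number_log\<close>, with \<open>z = 0\<close>.\<close>
    moreover have "- 1 - 0 = exp (L (t, 1) - L (0, t))" if "0 \<le> t" "t \<le> 1" for t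
    proof -
      have "exp (L (t, 1)) = - exp (L (0, t))"
        using Gedge[OF that] L[of "(t, 1)"] L[of "(0, t)"] that by simp
      then show ?thesis
        by (simp add: exp_diff)
    qed
    ultimately have "winding_number (\<lambda>t. - 1) 0
        = (L (1, 1) - L (0, 1) - (L (0, 1) - L (0, 0))) / (2 * of_real pi * \<i>)"
      by (rule winding_number_log(1))
    then have "L (1, 1) - L (0, 1) - (L (0, 1) - L (0, 0)) = 0"
      by (simp add: winding_number_zero_const)
    then show ?thesis
      by algebra
  qed
  moreover define k where "k = (L (0, 1) - L (0, 0)) / (2 * of_real pi * \<i>)"
  ultimately have "winding_number g' 0 = 2 * k"
    by simp
  have pathq: "path (\<lambda>t. L (0, t))"
    by (rule pathL) (auto intro!: continuous_intros)
  \<comment> \<open>\<sigma> selects the side of the curve; the two signs together leave only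
    \<open>k = 1 / 2\<close>.\<close>
  have side: "k + of_real (\<sigma> / 2) \<in> {0, 1}" if "\<sigma> = 1 \<or> \<sigma> = -1" for \<sigma>
  proof -
    have "exp (L (0, 0)) = g' 0" "exp (L (0, 1)) = - g' 0"
      using L[of "(0, 0)"] L[of "(0, 1)"] Gdiag G01 by simp_all
    moreover have "g t - g 0 = of_real (t * (1 - t)) * exp (L (0, t))" if "0 \<le> t" "t \<le> 1" for t
      using G[of 0 t] L[of "(0, t)"] that by simp
    ultimately obtain z where "z \<notin> path_image g" "winding_number g z = k + of_real (\<sigma> / 2)"
      using winding_number_displaced[OF pathq, of "g' 0" g "g 0" \<sigma>] \<open>\<sigma> = 1 \<or> \<sigma> = -1\<close>
      unfolding k_def by blast
    then show ?thesis
      using idx by metis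
  qed
  have "k = 1 / 2"
  proof -
    consider "k + 1 / 2 = 0" | "k + 1 / 2 = 1"
      using side[of 1] by auto
    then show ?thesis
    proof cases
      case 1
      then have "k - 1 / 2 = - 1"
        by algebra
      then show ?thesis
        using side[of "- 1"] by simp
    next
      case 2
      then show ?thesis
        by algebra
    qed
  qed
  then show ?thesis
    using \<open>winding_number g' 0 = 2 * k\<close> by (simp add: mult.commute)
qed

section \<open>Real linear maps and winding numbers\<close>

text \<open>Adding \<open>Ln a\<close> to a continuous logarithm of \<open>p\<close> gives one of
  the product, with the same increment.\<close>

lemma winding_number_mult_const:
  assumes "path p" "0 \<notin> path_image p" "a \<noteq> 0"
  shows "winding_number (\<lambda>t. a * p t) 0 = winding_number p 0"
proof -
  obtain q where q: "path q" "\<And>t. t \<in> {0..1} \<Longrightarrow> p t = 0 + exp (q t)"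
    by (rule winding_number_as_continuous_log[OF assms(1,2)]) (auto intro: that)
  have "winding_number p 0 = (q 1 - q 0) / (2 * of_real pi * \<i>)"
    using q by (intro winding_number_log(1)) auto
  moreover have "winding_number (\<lambda>t. a * p t) 0 = ((q 1 + Ln a) - (q 0 + Ln a)) / (2 * of_real pi * \<i>)"
    using q assms(3) by (intro winding_number_log(1)[of "\<lambda>t. q t + Ln a"])
      (auto simp: path_def exp_add intro!: continuous_intros)
  ultimately show ?thesis
    by simp
qed

lemma winding_number_real_linear:
  assumes p: "path p" "pathfinish p = pathstart p" "0 \<notin> path_image p"
    and ab: "cmod a \<noteq> cmod b"
  shows "winding_number (\<lambda>t. a * p t + b * cnj (p t)) 0
    = of_real (sgn ((cmod a)\<^sup>2 - (cmod b)\<^sup>2)) * winding_number p 0"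
proof -
  have contp: "continuous_on {0..1} p"
    using p by (simp add: path_def)
  have loop: "p 1 = p 0"
    using p by (simp add: pathfinish_def pathstart_def)
  have nz: "p t \<noteq> 0" if "t \<in> {0..1}" for t
    using p that by (auto simp: path_image_def)
  note defs = path_def pathfinish_def pathstart_def
  show ?thesis
  proof (cases "cmod b < cmod a")
    case True
    have "winding_number (\<lambda>t. a * p t + b * cnj (p t)) 0 = winding_number (\<lambda>t. a * p t) 0"
      using True by (intro winding_number_nearby_loops_eq)
        (auto simp: defs loop norm_mult nz intro!: continuous_intros contp)
    also have "\<dots> = winding_number p 0"
      using True p by (intro winding_number_mult_const) auto
    finally show ?thesis
      using True by (simp add: power_strict_mono)
  next
    case False
    then have *: "cmod a < cmod b"
      using ab by simp
    have "winding_number (\<lambda>t. a * p t + b * cnj (p t)) 0 = winding_number (\<lambda>t. b * cnj (p t)) 0"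
      using * by (intro winding_number_nearby_loops_eq)
        (auto simp: defs loop norm_mult nz intro!: continuous_intros contp)
    also have "\<dots> = winding_number (cnj \<circ> p) 0"
    proof -
      have "path (cnj \<circ> p)" "0 \<notin> path_image (cnj \<circ> p)"
        using nz by (auto simp: path_def path_image_def intro!: continuous_intros contp)
      then show ?thesis
        using * winding_number_mult_const[of "cnj \<circ> p" b] by (cases "b = 0") auto
    qed
    also have "\<dots> = - cnj (winding_number p 0)"
      using winding_number_cnj[OF p(1,3)] by simp
    \<comment> \<open>The winding number of a loop is an integer, hence fixed by
      \<open>cnj\<close>.\<close>
    also have "\<dots> = - winding_number p 0"
      using integer_winding_number[OF p] by (auto elim!: Ints_cases)
    finally show ?thesis
      using * by (simp add: power_strict_mono)
  qed
qed

section \<open>Curves in the plane\<close>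

lemma linear_complex_of_vec: "linear complex_of_vec"
  by (auto simp: complex_of_vec_def complex_eq_iff intro!: linearI)

lemma norm_complex_of_vec [simp]: "cmod (complex_of_vec v) = norm v"
  by (simp add: complex_of_vec_def norm_vec_def L2_set_def UNIV_2 cmod_def)

lemma complex_of_vec_eq_0_iff [simp]: "complex_of_vec v = 0 \<longleftrightarrow> v = 0"
  by (metis norm_complex_of_vec norm_eq_zero)

lemma inj_complex_of_vec: "inj complex_of_vec"
  by (simp add: linear_injective_0[OF linear_complex_of_vec])

lemma surj_complex_of_vec: "surj complex_of_vec"
proof (rule surjI)
  show "complex_of_vec (vector [Re z, Im z]) = z" for z
    by (simp add: complex_of_vec_def)
qed

lemma bounded_linear_complex_of_vec: "bounded_linear complex_of_vec"
  by (simp add: linear_complex_of_vec linear_linear)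

lemma continuous_on_complex_of_vec [continuous_intros]:
  "continuous_on S f \<Longrightarrow> continuous_on S (\<lambda>x. complex_of_vec (f x))"
  by (rule bounded_linear.continuous_on[OF bounded_linear_complex_of_vec])

text \<open>The norm-preserving map carries an unbounded component to an unbounded connected set off
  the image. This makes the vanishing of the index outside a complex path available for plane
  curves.\<close>

lemma outside_complex_of_vec:
  assumes "v \<in> outside S"
  shows "complex_of_vec v \<in> outside (complex_of_vec ` S)"
proof -
  let ?C = "connected_component_set (- S) v"
  have v: "v \<notin> S" and unb: "\<not> bounded ?C"
    using assms by (auto simp: outside_def)
  have "connected (complex_of_vec ` ?C)"
    by (intro connected_continuous_image continuous_intros connected_connected_component)
  moreover have "complex_of_vec ` ?C \<subseteq> - complex_of_vec ` S"
    using connected_component_subset[of "- S" v] by (auto dest: injD[OF inj_complex_of_vec])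
  moreover have "complex_of_vec v \<in> complex_of_vec ` ?C"
    using v by auto
  ultimately have sub: "complex_of_vec ` ?C
      \<subseteq> connected_component_set (- complex_of_vec ` S) (complex_of_vec v)"
    by (intro connected_component_maximal)
  have "\<not> bounded (complex_of_vec ` ?C)"
    using unb by (simp add: bounded_iff)
  then show ?thesis
    unfolding outside using sub bounded_subset by blast
qed

section \<open>Matrices and Jacobians\<close>

lemma matrix_vector_mult_2: "(A *v v) $ (i::2) = A $ i $ 1 * v $ 1 + A $ i $ (2::2) * (v $ 2 :: real)"
  by (simp add: matrix_vector_mult_def UNIV_2)

text \<open>\<open>a\<close> and \<open>b\<close> are the Wirtinger derivatives of the linear map
  given by \<open>A\<close>, and \<open>det A\<close> is its Jacobian determinant in terms of
  them.\<close>

lemma complex_of_vec_matrix: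
  fixes A :: "real^2^2"
  obtains a b where "\<And>v. complex_of_vec (A *v v) = a * complex_of_vec v + b * cnj (complex_of_vec v)"
    and "(cmod a)\<^sup>2 - (cmod b)\<^sup>2 = det A"
proof
  let ?a = "Complex ((A $ 1 $ 1 + A $ 2 $ 2) / 2) ((A $ 2 $ 1 - A $ 1 $ 2) / 2)"
  let ?b = "Complex ((A $ 1 $ 1 - A $ 2 $ 2) / 2) ((A $ 2 $ 1 + A $ 1 $ 2) / 2)"
  show "complex_of_vec (A *v v) = ?a * complex_of_vec v + ?b * cnj (complex_of_vec v)" for v
    by (simp add: complex_of_vec_def complex_eq_iff matrix_vector_mult_2 field_simps)
  show "(cmod ?a)\<^sup>2 - (cmod ?b)\<^sup>2 = det A"
    unfolding cmod_power2 by (simp add: det_2 power2_eq_square field_simps)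
qed

text \<open>Order one of \<open>higher_differentiable_on\<close> gives continuous directional
  derivatives; those along the basis vectors are the columns of the Jacobian.\<close>

lemma smooth_on_UNIV_has_derivative:
  fixes F :: "real^'n \<Rightarrow> real^'m"
  assumes "smooth_on UNIV F"
  shows "(F has_derivative (*v) (jacobian F (at x))) (at x)"
    and "continuous_on UNIV (\<lambda>x. jacobian F (at x))"
proof -
  have *: "higher_differentiable_on UNIV F (Suc 0)"
    using assms by (simp only: smooth_on_def)
  then show "(F has_derivative (*v) (jacobian F (at x))) (at x)"
    using jacobian_works[of F "at x"] by simp
  have "continuous_on UNIV (\<lambda>x. frechet_derivative F (at x) v)" for v
    using * by simp
  then show "continuous_on UNIV (\<lambda>x. jacobian F (at x))"
    unfolding jacobian_def matrix_def by (intro continuous_intros)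
qed

lemma continuous_on_matrix_vector_mult [continuous_intros]:
  fixes A :: "'a::topological_space \<Rightarrow> real^'n^'m"
  assumes "continuous_on S A" "continuous_on S v"
  shows "continuous_on S (\<lambda>x. A x *v v x)"
  unfolding matrix_vector_mult_def by (intro continuous_intros assms)

section \<open>The unit circle and positively oriented curves on it\<close>

lemma circle_param_in_sphere: "circle_param t \<in> sphere 0 1"
  by (simp add: circle_param_def norm_vec_def L2_set_def UNIV_2)

lemma circle_param_periodic: "circle_param (t + 2 * pi) = circle_param t"
  by (simp add: circle_param_def)

lemma circle_param_image: "(\<lambda>s. circle_param (2 * pi * s)) ` {0..1} = sphere 0 1"
proof
  show "(\<lambda>s. circle_param (2 * pi * s)) ` {0..1} \<subseteq> sphere 0 1"
    using circle_param_in_sphere by blast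
  show "sphere 0 1 \<subseteq> (\<lambda>s. circle_param (2 * pi * s)) ` {0..1}"
  proof
    fix v :: "real^2" assume "v \<in> sphere 0 1"
    then have "(v $ 1)\<^sup>2 + (v $ 2)\<^sup>2 = 1"
      by (simp add: norm_vec_def L2_set_def UNIV_2)
    then obtain t where t: "0 \<le> t" "t < 2 * pi" "v $ 1 = cos t" "v $ 2 = sin t"
      by (rule sincos_total_2pi)
    then have "v = circle_param (2 * pi * (t / (2 * pi)))"
      by (simp add: circle_param_def vec_eq_iff forall_2)
    moreover have "t / (2 * pi) \<in> {0..1}"
      using t by simp
    ultimately show "v \<in> (\<lambda>s. circle_param (2 * pi * s)) ` {0..1}"
      by blast
  qed
qed

lemma circle_param_inj:
  assumes "s < t" "t - s < 1"
  shows "circle_param (2 * pi * s) \<noteq> circle_param (2 * pi * t)"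
proof
  assume "circle_param (2 * pi * s) = circle_param (2 * pi * t)"
  then have "sin (2 * pi * t) = sin (2 * pi * s) \<and> cos (2 * pi * t) = cos (2 * pi * s)"
    by (simp add: circle_param_def vec_eq_iff forall_2)
  then obtain n :: int where "2 * pi * t = 2 * pi * s + 2 * pi * n"
    using sin_cos_eq_iff[of "2 * pi * t" "2 * pi * s"] by auto
  then have "2 * pi * t = 2 * pi * (s + n)"
    by (simp add: distrib_left)
  then have "t = s + n"
    by simp
  then show False
    using assms by auto
qed

text \<open>The Umlaufsatz for \<open>c\<close> rescaled to period 1: the index is 1 inside by
  orientation and 0 outside. Rescaling multiplies the velocity by 2\<pi>, which leaves its winding
  number around 0 unchanged.\<close>

lemma rotation_number_positively_oriented:
  assumes c: "prc_curve c" "inj_on c (sphere 0 1)" and pos: "positively_oriented c"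
  shows "rotation_number c = 1"
proof -
  define h where "h = c \<circ> circle_param"
  define h' where "h' t = vector_derivative h (at t)" for t
  have der: "(h has_vector_derivative h' t) (at t)" and cont: "continuous_on UNIV h'"
    and reg: "h' t \<noteq> 0" for t
    using c(1) unfolding prc_curve_def h_def[symmetric] C1_differentiable_on_eq h'_def
    by (auto simp: vector_derivative_works)
  define g where "g s = complex_of_vec (h (2 * pi * s))" for s
  define g' where "g' s = of_real (2 * pi) * complex_of_vec (h' (2 * pi * s))" for s
  have g_circle: "g s = complex_of_vec (c (circle_param (2 * pi * s)))" for s
    by (simp add: g_def h_def)
  have derg: "(g has_vector_derivative g' s) (at s)" for s
  proof -
    have "((\<lambda>s. 2 * pi * s) has_vector_derivative 2 * pi) (at s)"
      by (auto intro!: derivative_eq_intros)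
    from vector_diff_chain_at[OF this der]
    have "((\<lambda>s. h (2 * pi * s)) has_vector_derivative (2 * pi) *\<^sub>R h' (2 * pi * s)) (at s)"
      by (simp add: o_def)
    from bounded_linear.has_vector_derivative[OF bounded_linear_complex_of_vec this]
    show ?thesis
      by (simp only: g_def[abs_def] g'_def linear_cmul[OF linear_complex_of_vec] scaleR_conv_of_real[where 'a=complex])
  qed
  have cont': "continuous_on S (\<lambda>s. complex_of_vec (h' (2 * pi * s)))" for S
    by (intro continuous_intros continuous_on_compose2[OF cont]) auto
  have contg: "continuous_on S g" for S
    using derg by (meson continuous_at_imp_continuous_on has_vector_derivative_continuous)
  have image: "path_image g = complex_of_vec ` c ` sphere 0 1"
    unfolding path_image_def circle_param_image[symmetric] g_circle image_image ..
  have "winding_number g z \<in> {0, 1}" if z: "z \<notin> path_image g" for z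
  proof -
    obtain v where v: "z = complex_of_vec v"
      using surj_complex_of_vec by blast
    then have "v \<notin> c ` sphere 0 1"
      using z image by blast
    then consider "v \<in> inside (c ` sphere 0 1)" | "v \<in> outside (c ` sphere 0 1)"
      using inside_Un_outside by blast
    then show ?thesis
    proof cases
      case 1
      then show ?thesis
        using pos unfolding positively_oriented_def plane_winding_number_def v g_def[abs_def] h_def
        by simp
    next
      case 2
      then have "z \<in> outside (path_image g)"
        unfolding image v by (rule outside_complex_of_vec)
      moreover have "pathfinish g = pathstart g" "path g"
        using contg circle_param_periodic[of 0] by (simp_all add: pathfinish_def pathstart_def g_circle path_def)
      ultimately show ?thesis
        using winding_number_zero_in_outside by simp
    qed
  qed
  moreover have "g s \<noteq> g t" if "s < t" "t - s < 1" for s t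
    using circle_param_inj[OF that] inj_onD[OF c(2)] circle_param_in_sphere
    unfolding g_circle by (metis injD[OF inj_complex_of_vec])
  moreover have "g (t + 1) = g t" for t
    using circle_param_periodic[of "2 * pi * t"] by (simp add: g_circle distrib_left)
  moreover have "continuous_on UNIV g'"
    unfolding g'_def by (intro continuous_intros cont')
  ultimately have "winding_number g' 0 = 1"
    using reg by (intro umlaufsatz[OF derg]) (auto simp: g'_def)
  then show ?thesis
    using winding_number_mult_const[of "\<lambda>s. complex_of_vec (h' (2 * pi * s))" "of_real (2 * pi)"]
    by (simp add: rotation_number_def plane_winding_number_def g'_def[abs_def] h_def[symmetric]
        h'_def[symmetric] linear_0[OF linear_complex_of_vec] path_def cont' path_image_def reg image_iff)
qed

section \<open>Contraction of the disk and the image curve\<close>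

text \<open>The straight-line contraction of the ball to \<open>f p\<close> is transported to
  \<Delta> by the homeomorphism.\<close>

lemma homeomorphic_cball_contraction:
  fixes \<Delta> :: "'a::real_normed_vector set"
  assumes "\<Delta> homeomorphic cball (0::'b::real_normed_vector) 1" and p: "p \<in> \<Delta>"
  obtains K where "continuous_on ({0..1} \<times> \<Delta>) K" and "K ` ({0..1} \<times> \<Delta>) \<subseteq> \<Delta>"
    and "\<And>x. x \<in> \<Delta> \<Longrightarrow> K (0, x) = x" and "\<And>x. x \<in> \<Delta> \<Longrightarrow> K (1::real, x) = p"
proof -
  obtain f k where f: "homeomorphism \<Delta> (cball (0::'b) 1) f k"
    using assms(1) by (auto simp: homeomorphic_def)
  let ?m = "\<lambda>z::real \<times> 'a. (1 - fst z) *\<^sub>R f (snd z) + fst z *\<^sub>R f p"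
  have contf: "continuous_on \<Delta> f" and contk: "continuous_on (cball 0 1) k"
    and fp: "\<And>x. x \<in> \<Delta> \<Longrightarrow> f x \<in> cball 0 1" and kp: "\<And>y. y \<in> cball 0 1 \<Longrightarrow> k y \<in> \<Delta>"
    and kf: "\<And>x. x \<in> \<Delta> \<Longrightarrow> k (f x) = x"
    using homeomorphism_cont1[OF f] homeomorphism_cont2[OF f] homeomorphism_image1[OF f]
      homeomorphism_image2[OF f] homeomorphism_apply1[OF f] by blast+
  have m: "?m z \<in> cball 0 1" if "z \<in> {0..1} \<times> \<Delta>" for z
    by (rule convexD[OF convex_cball]) (use fp p that in auto)
  have "continuous_on ({0..1} \<times> \<Delta>) (\<lambda>z. f (snd z))"
    by (rule continuous_on_compose2[OF contf]) (auto intro!: continuous_intros)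
  then have "continuous_on ({0..1} \<times> \<Delta>) ?m"
    by (intro continuous_intros)
  then have "continuous_on ({0..1} \<times> \<Delta>) (\<lambda>z. k (?m z))"
    by (rule continuous_on_compose2[OF contk]) (use m in blast)
  moreover have "(\<lambda>z. k (?m z)) ` ({0..1} \<times> \<Delta>) \<subseteq> \<Delta>"
    using m kp by blast
  ultimately show ?thesis
    by (rule that) (simp_all add: kf p)
qed

theorem proposition13:
  fixes F :: "real^2 \<Rightarrow> real^2" and \<gamma> \<Delta> :: "(real^2) set"
  assumes "smooth_on UNIV F"
    and "excellent F"
    and "smooth_simple_closed_curve \<gamma>"
    and "closed_disk_bounded_by \<Delta> \<gamma>"
    and "\<Delta> \<inter> critical_set F = {}"
  shows "\<forall>c. simple_regular_parametrization c \<gamma> \<longrightarrow>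
           prc_curve (F \<circ> c) \<and>
           (positively_oriented c \<longrightarrow>
             (\<forall>p\<in>\<Delta>. rotation_number (F \<circ> c) = of_real (sgn (det (jacobian F (at p))))))"
proof (intro allI impI)
  fix c assume "simple_regular_parametrization c \<gamma>"
  then have c: "prc_curve c" "inj_on c (sphere 0 1)" "c ` sphere 0 1 = \<gamma>"
    by (auto simp: simple_regular_parametrization_def)
  define J where "J x = jacobian F (at x)" for x
  have derF: "(F has_derivative (*v) (J x)) (at x)" and contJ: "continuous_on UNIV J" for x
    using smooth_on_UNIV_has_derivative[OF assms(1)] by (simp_all add: J_def[abs_def])
  have disk: "\<Delta> homeomorphic cball (0::real^2) 1" "frontier \<Delta> = \<gamma>"
    using assms(4) by (auto simp: closed_disk_bounded_by_def)
  \<comment> \<open>A compact set contains its frontier, so DF is invertible along the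
    curve.\<close>
  have "compact \<Delta>"
    using homeomorphic_compactness[OF disk(1)] by simp
  then have sub: "\<gamma> \<subseteq> \<Delta>"
    using disk(2) by (metis compact_imp_closed frontier_subset_eq)
  have inv: "invertible (J x)" if "x \<in> \<Delta>" for x
    using assms(5) that by (auto simp: critical_set_def J_def)
  have Jnz: "J x *v v \<noteq> 0" if "x \<in> \<Delta>" "v \<noteq> 0" for x v
    using inv[OF that(1)] that(2) by (metis invertible_def matrix_vector_mul_assoc matrix_vector_mul_lid matrix_vector_mult_0_right)
  define h where "h = c \<circ> circle_param"
  define h' where "h' t = vector_derivative h (at t)" for t
  have der: "(h has_vector_derivative h' t) (at t)" and conth': "continuous_on UNIV h'"
    and reg: "h' t \<noteq> 0" for t
    using c(1) unfolding prc_curve_def h_def[symmetric] C1_differentiable_on_eq h'_def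
    by (auto simp: vector_derivative_works)
  have conth: "continuous_on UNIV h"
    using der by (meson continuous_at_imp_continuous_on has_vector_derivative_continuous)
  have h\<Delta>: "h t \<in> \<Delta>" for t
    using c(3) sub circle_param_in_sphere by (auto simp: h_def)
  have derFh: "(F \<circ> c \<circ> circle_param has_vector_derivative J (h t) *v h' t) (at t)" for t
    using diff_chain_at[OF der[unfolded has_vector_derivative_def] derF]
    by (simp add: has_vector_derivative_def o_def h_def matrix_vector_mult_scaleR)
  have "continuous_on UNIV (\<lambda>t. J (h t) *v h' t)"
    by (intro continuous_intros conth' continuous_on_compose2[OF contJ conth]) auto
  then have "(F \<circ> c \<circ> circle_param) C1_differentiable_on UNIV"
    using derFh unfolding C1_differentiable_on_def
    by (intro exI[of _ "\<lambda>t. J (h t) *v h' t"]) simp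
  then have prc: "prc_curve (F \<circ> c)"
    using Jnz[OF h\<Delta> reg] by (simp add: prc_curve_def vector_derivative_at[OF derFh])
  have "rotation_number (F \<circ> c) = of_real (sgn (det (J p)))"
    if pos: "positively_oriented c" and p: "p \<in> \<Delta>" for p
  proof -
    let ?w = "\<lambda>s. complex_of_vec (h' (2 * pi * s))"
    have h_per: "h (t + 2 * pi) = h t" for t
      by (simp add: h_def circle_param_periodic)
    have h'_per: "h' (2 * pi) = h' 0"
      using has_vector_derivative_periodic[OF der h_per, of 0] by simp
    obtain K where K: "continuous_on ({0..1::real} \<times> \<Delta>) K" "K ` ({0..1} \<times> \<Delta>) \<subseteq> \<Delta>"
      "\<And>x. x \<in> \<Delta> \<Longrightarrow> K (0, x) = x" "\<And>x. x \<in> \<Delta> \<Longrightarrow> K (1, x) = p"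
      by (rule homeomorphic_cball_contraction[OF disk(1) p]) (rule that)
    \<comment> \<open>The homotopy moves only the point at which DF is taken, from the point of the
      curve to \<open>p\<close>; the vector \<open>h'\<close> stays. It avoids 0 because
      \<open>K\<close> never leaves \<Delta>.\<close>
    let ?H = "\<lambda>z. complex_of_vec (J (K (fst z, h (2 * pi * snd z))) *v h' (2 * pi * snd z))"
    have "continuous_on ({0..1} \<times> {0..1}) ?H"
    proof (intro continuous_intros)
      have "continuous_on ({0..1::real} \<times> {0..1}) (\<lambda>z. K (fst z, h (2 * pi * snd z)))"
        by (rule continuous_on_compose2[OF K(1)])
          (auto intro!: continuous_intros continuous_on_compose2[OF conth] simp: h\<Delta>)
      then show "continuous_on ({0..1::real} \<times> {0..1}) (\<lambda>z. J (K (fst z, h (2 * pi * snd z))))"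
        by (rule continuous_on_compose2[OF contJ]) auto
      show "continuous_on ({0..1::real} \<times> {0..1}) (\<lambda>z. h' (2 * pi * snd z))"
        by (rule continuous_on_compose2[OF conth']) (auto intro!: continuous_intros)
    qed
    moreover have "?H \<in> {0..1} \<times> {0..1} \<rightarrow> - {0}"
    proof
      fix z :: "real \<times> real" assume "z \<in> {0..1} \<times> {0..1}"
      then have "K (fst z, h (2 * pi * snd z)) \<in> \<Delta>"
        using K(2) h\<Delta> by (auto simp: image_subset_iff)
      then show "?H z \<in> - {0}"
        using Jnz reg by simp
    qed
    moreover have "pathfinish (?H \<circ> Pair t) = pathstart (?H \<circ> Pair t)" for t
      using h_per[of 0] h'_per by (simp add: pathfinish_def pathstart_def)
    ultimately have "homotopic_loops (- {0}) (\<lambda>s. ?H (0, s)) (\<lambda>s. ?H (1, s))"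
      unfolding homotopic_loops by blast
    then have "winding_number (\<lambda>s. ?H (0, s)) 0 = winding_number (\<lambda>s. ?H (1, s)) 0"
      by (rule winding_number_homotopic_loops)
    then have "rotation_number (F \<circ> c) = winding_number (\<lambda>s. complex_of_vec (J p *v h' (2 * pi * s))) 0"
      by (simp add: rotation_number_def plane_winding_number_def vector_derivative_at[OF derFh]
          K h\<Delta> linear_0[OF linear_complex_of_vec])
    \<comment> \<open>Once the base point is fixed at \<open>p\<close>, a single real linear map
      acts on the velocity of \<open>c\<close>; the sign of its determinant multiplies the winding
      number 1 given by the Umlaufsatz.\<close>
    moreover obtain a b where
      ab: "\<And>v. complex_of_vec (J p *v v) = a * complex_of_vec v + b * cnj (complex_of_vec v)"
      and det: "(cmod a)\<^sup>2 - (cmod b)\<^sup>2 = det (J p)"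
      by (rule complex_of_vec_matrix[of "J p"]) (rule that)
    moreover have "winding_number (\<lambda>s. a * ?w s + b * cnj (?w s)) 0
        = of_real (sgn ((cmod a)\<^sup>2 - (cmod b)\<^sup>2)) * winding_number ?w 0"
    proof (rule winding_number_real_linear)
      show "path ?w"
        unfolding path_def by (intro continuous_intros continuous_on_compose2[OF conth']) auto
      show "pathfinish ?w = pathstart ?w"
        by (simp add: pathfinish_def pathstart_def h'_per)
      show "0 \<notin> path_image ?w"
        by (auto simp: path_image_def reg)
      show "cmod a \<noteq> cmod b"
        using det inv[OF p] by (auto simp: invertible_det_nz)
    qed
    moreover have "winding_number ?w 0 = 1"
      using rotation_number_positively_oriented[OF c(1,2) pos]
      by (simp add: rotation_number_def plane_winding_number_def h_def[symmetric] h'_def[symmetric]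
          linear_0[OF linear_complex_of_vec])
    ultimately show ?thesis
      by simp
  qed
  with prc show "prc_curve (F \<circ> c) \<and> (positively_oriented c \<longrightarrow>
      (\<forall>p\<in>\<Delta>. rotation_number (F \<circ> c) = of_real (sgn (det (jacobian F (at p))))))"
    by (simp add: J_def)
qed

end
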